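(* Let $F$ be a field with $\mathrm{char}(F)\neq 2$, let $L$ be a perfect Lie algebra over $F$ (that is, $[L,L]=L$), and let $M$ be an $L$-module such that $Z_M(L)=\{0\}$. Then for every skew-symmetric biderivation $\delta:L\times L\to M$ there exists $\gamma\in\mathrm{Cent}(M)$ such that $\delta(x,y)=\gamma([x,y])$ for all $x,y\in L$.
   Context: Neither $L$ nor $M$ is assumed finite dimensional. The action of $x\in L$ on $v\in M$ is written $x\cdot v$. A skew-symmetric biderivation $\delta:L\times L\to M$ is an $F$-bilinear map such that $\delta(x,y)=-\delta(y,x)$ for all $x,y\in L$ and $\delta([x,y],z)=x\cdot\delta(y,z)-y\cdot\delta(x,z)$ for all $x,y,z\in L$. For a subset $S\subseteq L$, $Z_M(S)=\{v\in M : s\cdot v=0 \text{ for all } s\in S\}$. The centroid of $M$, $\mathrm{Cent}(M)$, is the space of all $F$-linear maps $\gamma:L\to M$ with $\gamma([x,y])=x\cdot\gamma(y)$ for all $x,y\in L$ (i.e. $L$-module homomorphisms from the adjoint module $L$ to $M$). *)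

theory Defs
  imports Complex_Main
begin

text \<open>
  All structures live on whole types: the field is a type of class field, and \<open>L\<close> and \<open>M\<close> are
  types of class ab_group_add carrying explicit scalar multiplications, as in the locale
  vector_space. There is no finiteness or dimension restriction.
\<close>

definition bilinear_map ::
  "('f::field \<Rightarrow> 'a::ab_group_add \<Rightarrow> 'a) \<Rightarrow> ('f \<Rightarrow> 'b::ab_group_add \<Rightarrow> 'b) \<Rightarrow>
   ('f \<Rightarrow> 'c::ab_group_add \<Rightarrow> 'c) \<Rightarrow> ('a \<Rightarrow> 'b \<Rightarrow> 'c) \<Rightarrow> bool"
  where "bilinear_map s1 s2 s3 f \<longleftrightarrow>
    (\<forall>x. Vector_Spaces.linear s2 s3 (\<lambda>y. f x y)) \<and>
    (\<forall>y. Vector_Spaces.linear s1 s3 (\<lambda>x. f x y))"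

locale lie_algebra = vector_space scale
  for scale :: "'f::field \<Rightarrow> 'l::ab_group_add \<Rightarrow> 'l" +
  fixes br :: "'l \<Rightarrow> 'l \<Rightarrow> 'l"
  assumes br_bilinear: "bilinear_map scale scale scale br"
    and br_self: "br x x = 0"
    and jacobi: "br x (br y z) + br y (br z x) + br z (br x y) = 0"

locale lie_module = lie_algebra scaleL br + M: vector_space scaleM
  for scaleL :: "'f::field \<Rightarrow> 'l::ab_group_add \<Rightarrow> 'l"
    and br :: "'l \<Rightarrow> 'l \<Rightarrow> 'l"
    and scaleM :: "'f \<Rightarrow> 'm::ab_group_add \<Rightarrow> 'm" +
  fixes act :: "'l \<Rightarrow> 'm \<Rightarrow> 'm"
  assumes act_bilinear: "bilinear_map scaleL scaleM scaleM act"
    and act_br: "act (br x y) v = act x (act y v) - act y (act x v)"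

text \<open>\<open>[A, B]\<close> is the linear span of the brackets, not merely the set of brackets.\<close>

definition lie_product ::
  "('f::field \<Rightarrow> 'l::ab_group_add \<Rightarrow> 'l) \<Rightarrow> ('l \<Rightarrow> 'l \<Rightarrow> 'l) \<Rightarrow> 'l set \<Rightarrow> 'l set \<Rightarrow> 'l set"
  where "lie_product scale br A B = module.span scale {br a b | a b. a \<in> A \<and> b \<in> B}"

definition perfect ::
  "('f::field \<Rightarrow> 'l::ab_group_add \<Rightarrow> 'l) \<Rightarrow> ('l \<Rightarrow> 'l \<Rightarrow> 'l) \<Rightarrow> bool"
  where "perfect scale br \<longleftrightarrow> lie_product scale br UNIV UNIV = UNIV"

text \<open>\<open>Z_M(S)\<close>; the module \<open>M\<close> enters through its action.\<close>

definition mod_centralizer :: "('l \<Rightarrow> 'm \<Rightarrow> 'm::ab_group_add) \<Rightarrow> 'l set \<Rightarrow> 'm set"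
  where "mod_centralizer act S = {v. \<forall>s\<in>S. act s v = 0}"

definition skew_biderivation ::
  "('f::field \<Rightarrow> 'l::ab_group_add \<Rightarrow> 'l) \<Rightarrow> ('l \<Rightarrow> 'l \<Rightarrow> 'l) \<Rightarrow>
   ('f \<Rightarrow> 'm::ab_group_add \<Rightarrow> 'm) \<Rightarrow> ('l \<Rightarrow> 'm \<Rightarrow> 'm) \<Rightarrow> ('l \<Rightarrow> 'l \<Rightarrow> 'm) \<Rightarrow> bool"
  where "skew_biderivation scaleL br scaleM act \<delta> \<longleftrightarrow>
    bilinear_map scaleL scaleL scaleM \<delta> \<and>
    (\<forall>x y. \<delta> x y = - \<delta> y x) \<and>
    (\<forall>x y z. \<delta> (br x y) z = act x (\<delta> y z) - act y (\<delta> x z))"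

definition Cent ::
  "('f::field \<Rightarrow> 'l::ab_group_add \<Rightarrow> 'l) \<Rightarrow> ('l \<Rightarrow> 'l \<Rightarrow> 'l) \<Rightarrow>
   ('f \<Rightarrow> 'm::ab_group_add \<Rightarrow> 'm) \<Rightarrow> ('l \<Rightarrow> 'm \<Rightarrow> 'm) \<Rightarrow> ('l \<Rightarrow> 'm) set"
  where "Cent scaleL br scaleM act =
    {\<gamma>. Vector_Spaces.linear scaleL scaleM \<gamma> \<and> (\<forall>x y. \<gamma> (br x y) = act x (\<gamma> y))}"

end

theory Submission
  imports Defs
begin

text \<open>
  Expanding \<open>\<delta>([x,y],[z,w])\<close> in two ways gives a four-variable identity for
  \<open>[x,z]\<cdot>\<delta>(y,w) + [y,w]\<cdot>\<delta>(x,z)\<close> whose symmetries force this sum to vanish when 2 is invertible.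
  Since an element of \<open>M\<close> is determined by the action of all brackets \<open>[c,d]\<close> on it, the relation
  \<open>[c,d]\<cdot>v = - z\<cdot>\<delta>(c,d)\<close> then defines \<open>v = \<gamma>(z)\<close>, and \<open>\<gamma>([x,y]) = \<delta>(x,y)\<close>.
  That \<open>\<gamma>\<close> commutes with the action amounts to the vanishing of the alternating expression
  \<open>x\<cdot>\<delta>(a,b) + a\<cdot>\<delta>(b,x) + b\<cdot>\<delta>(x,a)\<close>; acting by \<open>[c,d]\<close> yields a function of five variables on
  which every transposition acts by \<open>-1\<close>, but also the even permutation exchanging \<open>(c,d)\<close> with
  \<open>(a,b)\<close>, so it is zero.
\<close>

lemma eq_neg_self_imp_zero:
  fixes scale :: "'f::field \<Rightarrow> 'm::ab_group_add \<Rightarrow> 'm" and v :: 'm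
  assumes "vector_space scale" "CHAR('f) \<noteq> 2" "v = - v"
  shows "v = 0"
proof -
  interpret vector_space scale by fact
  \<comment> \<open>The divisors of 2 are 1 and 2, so excluding characteristic 1 makes 2
    invertible.\<close>
  have "CHAR('f) \<noteq> 1"
    by (metis of_nat_1 of_nat_CHAR zero_neq_one)
  then have "\<not> CHAR('f) dvd 2"
    using assms(2) dvd_imp_le[of "CHAR('f)" 2] by (cases "CHAR('f) = 0") (force, linarith)
  then have "of_nat 2 \<noteq> (0::'f)"
    by (simp only: of_nat_eq_0_iff_char_dvd not_False_eq_True)
  moreover have "scale (of_nat 2) v = v + v"
    by (metis of_nat_numeral one_add_one scale_left_distrib scale_one)
  moreover have "v + v = 0"
    using assms(3) by (metis add.right_inverse)
  ultimately show ?thesis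
    by (metis scale_eq_0_iff)
qed

locale perfect_lie_module = lie_module +
  assumes perfect: "perfect scaleL br"
    and centralizer: "mod_centralizer act UNIV = {0}"
begin

lemma hom_act_left: "module_hom scaleL scaleM (\<lambda>x. act x v)"
  and hom_act_right: "module_hom scaleM scaleM (act x)"
  and hom_br_left: "module_hom scaleL scaleL (\<lambda>x. br x y)"
  and hom_br_right: "module_hom scaleL scaleL (br x)"
  using act_bilinear br_bilinear unfolding bilinear_map_def Vector_Spaces.linear_def by blast+

lemmas act_left_simps =
    module_hom.add[OF hom_act_left]
    module_hom.neg[OF hom_act_left]
    module_hom.zero[OF hom_act_left]
    module_hom.scale[OF hom_act_left]

lemmas act_right_simps =
    module_hom.add[OF hom_act_right]
    module_hom.neg[OF hom_act_right]
    module_hom.diff[OF hom_act_right]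
    module_hom.zero[OF hom_act_right]
    module_hom.scale[OF hom_act_right]

lemmas br_right_simps =
    module_hom.add[OF hom_br_right]
    module_hom.zero[OF hom_br_right]
    module_hom.scale[OF hom_br_right]

lemma br_skew: "br x y = - br y x"
proof -
  have "br (x + y) (x + y) = br x x + br x y + (br y x + br y y)"
    by (simp only: br_right_simps module_hom.add[OF hom_br_left] ac_simps)
  then have "br x y + br y x = 0"
    by (simp add: br_self)
  then show ?thesis
    by (simp only: eq_neg_iff_add_eq_0)
qed

text \<open>Perfectness makes the brackets span, so closure under linear combinations
  suffices.\<close>

lemma bracket_induct [case_names zero bracket add scale]:
  assumes "P 0" and "\<And>a b. P (br a b)"
    and "\<And>x y. P x \<Longrightarrow> P y \<Longrightarrow> P (x + y)" and "\<And>c x. P x \<Longrightarrow> P (scaleL c x)"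
  shows "P x"
proof -
  have "x \<in> span {br a b | a b. a \<in> UNIV \<and> b \<in> UNIV}"
    using perfect unfolding perfect_def lie_product_def by blast
  then show ?thesis
    by (induction rule: span_induct_alt) (auto intro: assms)
qed

text \<open>The annihilator of \<open>v\<close> in \<open>L\<close> is a subspace containing all
  brackets, hence all of \<open>L\<close>, so \<open>v\<close> lies in
  \<open>Z_M(L)\<close>.\<close>

lemma zero_if_brackets_act_zero:
  assumes "\<And>c d. act (br c d) v = 0"
  shows "v = 0"
proof -
  have "act x v = 0" for x
    by (induction x rule: bracket_induct) (simp_all add: assms act_left_simps)
  then show ?thesis
    using centralizer unfolding mod_centralizer_def by blast
qed

lemma eq_if_brackets_act_eq:
  assumes "\<And>c d. act (br c d) v = act (br c d) w"
  shows "v = w"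
  using zero_if_brackets_act_zero[of "v - w"] assms by (simp add: act_right_simps)

end

locale perfect_lie_module_biderivation = perfect_lie_module scaleL br scaleM act
  for scaleL :: "'f::field \<Rightarrow> 'l::ab_group_add \<Rightarrow> 'l"
    and br :: "'l \<Rightarrow> 'l \<Rightarrow> 'l"
    and scaleM :: "'f \<Rightarrow> 'm::ab_group_add \<Rightarrow> 'm"
    and act :: "'l \<Rightarrow> 'm \<Rightarrow> 'm" +
  fixes \<delta> :: "'l \<Rightarrow> 'l \<Rightarrow> 'm"
  assumes char_not_2: "CHAR('f) \<noteq> 2"
    and biderivation: "skew_biderivation scaleL br scaleM act \<delta>"
begin

lemmas zero_if_eq_neg = eq_neg_self_imp_zero[OF M.vector_space_axioms char_not_2]

lemma skew: "\<delta> x y = - \<delta> y x"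
  and derivation_left: "\<delta> (br x y) z = act x (\<delta> y z) - act y (\<delta> x z)"
  using biderivation unfolding skew_biderivation_def by blast+

lemma derivation_right: "\<delta> z (br x y) = act x (\<delta> z y) - act y (\<delta> z x)"
  using derivation_left[of x y z] skew[of z "br x y"] skew[of z x] skew[of z y]
  by (simp add: act_right_simps)

lemma bracket_act_antisym: "act (br x z) (\<delta> y w) = - act (br y w) (\<delta> x z)"
proof -
  define S where "S x z y w = act (br x z) (\<delta> y w) + act (br y w) (\<delta> x z)" for x z y w
  have skew12: "S x z y w = - S z x y w" for x z y w
    unfolding S_def using br_skew[of x z] skew[of x z]
    by (simp add: act_left_simps act_right_simps)
  have exchange: "S x z y w = S x w y z" for x z y w
  proof -
    have "\<delta> (br x y) (br z w) = act x (\<delta> y (br z w)) - act y (\<delta> x (br z w))"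
      by (rule derivation_left)
    moreover have "\<delta> (br x y) (br z w) = act z (\<delta> (br x y) w) - act w (\<delta> (br x y) z)"
      by (rule derivation_right)
    ultimately have
      "act x (act z (\<delta> y w) - act w (\<delta> y z)) - act y (act z (\<delta> x w) - act w (\<delta> x z)) =
       act z (act x (\<delta> y w) - act y (\<delta> x w)) - act w (act x (\<delta> y z) - act y (\<delta> x z))"
      by (simp only: derivation_left derivation_right)
    then show ?thesis
      unfolding S_def by (simp add: act_br act_right_simps algebra_simps)
  qed
  \<comment> \<open>The swap of positions 2 and 4 keeps \<open>S\<close>, the swap of positions 1
    and 2 negates it. Their product is a 3-cycle, so alternating them three times restores the
    arguments with three sign changes.\<close>
  have "S x z y w = S x w y z"
    by (rule exchange)
  also have "\<dots> = - S w x y z"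
    by (rule skew12)
  also have "\<dots> = - S w z y x"
    by (simp only: exchange[of w x])
  also have "\<dots> = S z w y x"
    by (simp only: skew12[of w z] minus_minus)
  also have "\<dots> = S z x y w"
    by (rule exchange)
  also have "\<dots> = - S x z y w"
    by (rule skew12)
  finally have "S x z y w = - S x z y w" .
  then have "S x z y w = 0"
    by (rule zero_if_eq_neg)
  then show ?thesis
    unfolding S_def by (simp add: eq_neg_iff_add_eq_0)
qed

lemma cyclic_sum_zero: "act x (\<delta> a b) + act a (\<delta> b x) + act b (\<delta> x a) = 0"
proof (rule zero_if_brackets_act_zero)
  fix c d
  define W where "W x a b = act x (\<delta> a b) + act a (\<delta> b x) + act b (\<delta> x a)" for x a b
  have rotate: "W x a b = W a b x" for x a b
    unfolding W_def by (simp add: algebra_simps)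
  \<comment> \<open>In this form \<open>W\<close> is the defect of equivariance of
    \<open>\<delta> x\<close> on brackets.\<close>
  have W_eq: "W x a b = act x (\<delta> a b) - \<delta> x (br a b)" for x a b
    unfolding W_def derivation_right using skew[of b x]
    by (simp add: act_right_simps)
  have exchange: "act (br c d) (W x a b) = - act (br a b) (W x c d)" for c d x a b
  proof -
    \<comment> \<open>Both terms of \<open>W_eq\<close> are expanded under \<open>[c,d]\<close>.
      Each produces the same \<open>- x\<cdot>([a,b]\<cdot>\<delta>(c,d))\<close>, which cancels in
      the difference.\<close>
    have "act (br c d) (act x (\<delta> a b)) =
        act x (act (br c d) (\<delta> a b)) + act (br (br c d) x) (\<delta> a b)"
      by (simp add: act_br[of "br c d" x])
    also have "\<dots> = - act x (act (br a b) (\<delta> c d)) + act (br a b) (\<delta> x (br c d))"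
      using bracket_act_antisym[of c d a b] bracket_act_antisym[of "br c d" x a b]
        skew[of "br c d" x]
      by (simp add: act_right_simps)
    finally have "act (br c d) (act x (\<delta> a b)) = \<dots>" .
    moreover have "act (br c d) (\<delta> x (br a b)) =
        - act x (act (br a b) (\<delta> c d)) + act (br a b) (act x (\<delta> c d))"
      using bracket_act_antisym[of c d x "br a b"] by (simp add: act_br[of x "br a b"])
    ultimately show ?thesis
      unfolding W_eq by (simp add: act_right_simps)
  qed
  \<comment> \<open>Place \<open>c, d, x, a, b\<close> on a circle: the bracket takes two neighbours
    and \<open>W\<close> the other three in order. Each step shifts everything three places and
    changes the sign; five steps return to the start with an odd number of signs.\<close>
  have "act (br c d) (W x a b) = - act (br a b) (W c d x)"
    using exchange rotate by metis
  also have "\<dots> = act (br d x) (W a b c)"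
    using exchange rotate by metis
  also have "\<dots> = - act (br b c) (W d x a)"
    using exchange rotate by metis
  also have "\<dots> = act (br x a) (W b c d)"
    using exchange rotate by metis
  also have "\<dots> = - act (br c d) (W x a b)"
    using exchange rotate by metis
  finally have "act (br c d) (W x a b) = 0"
    by (rule zero_if_eq_neg)
  then show "act (br c d) (act x (\<delta> a b) + act a (\<delta> b x) + act b (\<delta> x a)) = 0"
    unfolding W_def .
qed

lemma biderivation_equivariant: "\<delta> x (br a b) = act x (\<delta> a b)"
  using cyclic_sum_zero[of x a b] skew[of b x]
  by (simp add: derivation_right act_right_simps algebra_simps)

text \<open>Characterizing the value by the action avoids writing \<open>z\<close> as a sum of
  brackets and checking independence of that choice. Linearity then follows from uniqueness.\<close>

definition \<gamma> :: "'l \<Rightarrow> 'm"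
  where "\<gamma> z = (THE v. \<forall>c d. act (br c d) v = - act z (\<delta> c d))"

lemma \<gamma>_eqI:
  assumes "\<And>c d. act (br c d) v = - act z (\<delta> c d)"
  shows "\<gamma> z = v"
  unfolding \<gamma>_def
proof (rule the_equality)
  fix w
  assume "\<forall>c d. act (br c d) w = - act z (\<delta> c d)"
  then show "w = v"
    by (simp add: assms eq_if_brackets_act_eq[of w v])
qed (use assms in blast)

lemma bracket_act_\<gamma>: "act (br c d) (\<gamma> z) = - act z (\<delta> c d)"
proof -
  have "\<exists>v. \<forall>c d. act (br c d) v = - act z (\<delta> c d)"
  proof (induction z rule: bracket_induct)
    case zero
    show ?case by (intro exI[of _ 0]) (simp add: act_left_simps act_right_simps)
  next
    case (bracket a b)
    \<comment> \<open>The witness is \<open>\<delta> a b\<close>.\<close>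
    show ?case using bracket_act_antisym by blast
  next
    case (add x y)
    then obtain v w where "\<forall>c d. act (br c d) v = - act x (\<delta> c d)"
      "\<forall>c d. act (br c d) w = - act y (\<delta> c d)" by blast
    then show ?case
      by (intro exI[of _ "v + w"]) (simp add: act_left_simps act_right_simps)
  next
    case (scale k x)
    then obtain v where "\<forall>c d. act (br c d) v = - act x (\<delta> c d)" by blast
    then show ?case
      by (intro exI[of _ "scaleM k v"]) (simp add: act_left_simps act_right_simps)
  qed
  then show ?thesis using \<gamma>_eqI by metis
qed

lemma \<gamma>_br: "\<gamma> (br x y) = \<delta> x y"
  by (rule \<gamma>_eqI) (rule bracket_act_antisym)

lemma \<gamma>_add: "\<gamma> (x + y) = \<gamma> x + \<gamma> y"
  by (rule \<gamma>_eqI) (simp add: bracket_act_\<gamma> act_left_simps act_right_simps)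

lemma \<gamma>_scale: "\<gamma> (scaleL k x) = scaleM k (\<gamma> x)"
  by (rule \<gamma>_eqI) (simp add: bracket_act_\<gamma> act_left_simps act_right_simps)

lemma \<gamma>_zero: "\<gamma> 0 = 0"
  by (rule \<gamma>_eqI) (simp add: act_left_simps act_right_simps)

lemma \<gamma>_act: "\<gamma> (br x y) = act x (\<gamma> y)"
proof (induction y rule: bracket_induct)
  case (bracket a b)
  \<comment> \<open>Both sides reduce to values of \<open>\<delta>\<close>:
    \<open>\<gamma>([x,[a,b]]) = \<delta>(x,[a,b]) = x\<cdot>\<delta>(a,b)\<close>.\<close>
  show ?case by (simp add: \<gamma>_br biderivation_equivariant)
qed (simp_all add: br_right_simps act_right_simps \<gamma>_zero \<gamma>_add \<gamma>_scale)

lemma \<gamma>_in_Cent: "\<gamma> \<in> Cent scaleL br scaleM act"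
  unfolding Cent_def
  using \<gamma>_act \<gamma>_add \<gamma>_scale vector_space_axioms M.vector_space_axioms
  by (auto simp: Vector_Spaces.linear_iff)

end

theorem theorem2p3:
  fixes scaleL :: "'f::field \<Rightarrow> 'l::ab_group_add \<Rightarrow> 'l"
    and br :: "'l \<Rightarrow> 'l \<Rightarrow> 'l"
    and scaleM :: "'f \<Rightarrow> 'm::ab_group_add \<Rightarrow> 'm"
    and act :: "'l \<Rightarrow> 'm \<Rightarrow> 'm"
  assumes "CHAR('f) \<noteq> 2"
    and "lie_algebra scaleL br"
    and "perfect scaleL br"
    and "lie_module scaleL br scaleM act"
    and "mod_centralizer act UNIV = {0}"
  shows "\<forall>\<delta>. skew_biderivation scaleL br scaleM act \<delta> \<longrightarrow>
    (\<exists>\<gamma>\<in>Cent scaleL br scaleM act. \<forall>x y. \<delta> x y = \<gamma> (br x y))"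
proof (intro allI impI)
  fix \<delta>
  assume "skew_biderivation scaleL br scaleM act \<delta>"
  then interpret perfect_lie_module_biderivation scaleL br scaleM act \<delta>
    using assms
    by (intro perfect_lie_module_biderivation.intro perfect_lie_module.intro
        perfect_lie_module_axioms.intro perfect_lie_module_biderivation_axioms.intro)
  show "\<exists>\<gamma>\<in>Cent scaleL br scaleM act. \<forall>x y. \<delta> x y = \<gamma> (br x y)"
    using \<gamma>_in_Cent by (intro bexI[of _ \<gamma>]) (simp_all add: \<gamma>_br)
qed

end
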